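(* Let $n$ be a positive integer and $w \in S_n$. Then \[ \overleftarrow{\mathfrak{S}}_w(x_i \mapsto q^{i-1}) = \sum_{a \in \mathsf{Reduced}(w)} \frac{q^{\sum a+\operatorname{comaj}(a)}}{(q-1)(q^{2}-1)\cdots (q^{\ell(a)}-1)}, \] where each summand on the right is expanded as a Laurent series in $q^{-1}$.
   Context: Let $x_i$ ($i\in\mathbb{Z}$) be commuting indeterminates. A word is a finite sequence $a=a_1a_2\cdots a_p$ of letters from a totally ordered alphabet (here integers); $\ell(a)=p$ and $\sum a=\sum_{i=1}^p a_i$. For a word $a=a_1\cdots a_p$, a bounded compatible sequence is a weakly increasing integer sequence $\mathbf{i}=(i_1\le \dots\le i_p)$ such that $i_j<i_{j+1}$ whenever $a_j\le a_{j+1}$, and $i_j\le a_j$ whenever $0<i_j$; $\mathsf{Compatible}(a)$ is the set of these, and $x_{\mathbf{i}}=x_{i_1}\cdots x_{i_p}$. Let $s_i=(i,i+1)$ be the transposition of $\mathbb{Z}$, and $S_n=\langle s_1,\dots,s_{n-1}\rangle$. A reduced word for $w$ is a word $a_1\cdots a_p$ of minimal length with $w=s_{a_1}\cdots s_{a_p}$; $\mathsf{Reduced}(w)$ is the set of these. The backstable Schubert polynomial is $\overleftarrow{\mathfrak{S}}_w=\sum_{a\in\mathsf{Reduced}(w)}\sum_{\mathbf{i}\in\mathsf{Compatible}(a)}x_{\mathbf{i}}\in\mathbb{Z}[[\dots,x_{-1},x_0,x_1,\dots,x_{n-1}]]$. For a homogeneous power series $F$ in the variables $x_i$, $i<n$,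 $F(x_i\mapsto q^{i-1})$ denotes the (well-defined) formal Laurent series in $q^{-1}$ obtained by setting $x_i=q^{i-1}$ for all integers $i<n$. Also $\operatorname{comaj}(a)=\sum_{i:\,a_i<a_{i+1}} i$. *)

theory Defs
  imports
    "HOL-Combinatorics.Transposition"
    "HOL-Algebra.Bij"
    "HOL-Algebra.Generated_Groups"
    "HOL-Library.Poly_Mapping"
    "HOL-Computational_Algebra.Formal_Laurent_Series"
    "HOL-Analysis.Infinite_Sum"
begin

definition simple_refl :: "int \<Rightarrow> int \<Rightarrow> int" where
  "simple_refl i = transpose i (i + 1)"

(* The subgroup of Sym(Z) generated by s_1, ..., s_{n-1}. *)
definition symgrp :: "nat \<Rightarrow> (int \<Rightarrow> int) set" where
  "symgrp n = generate (BijGroup UNIV) (simple_refl ` {1..<int n})"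

(* word_perm [a_1, ..., a_p] = s_{a_1} o ... o s_{a_p} *)
definition word_perm :: "int list \<Rightarrow> int \<Rightarrow> int" where
  "word_perm a = foldr (\<circ>) (map simple_refl a) id"

(* Letters range over all of Z, not only over 1, ..., n-1. *)
definition Reduced :: "(int \<Rightarrow> int) \<Rightarrow> int list set" where
  "Reduced w =
     {a. word_perm a = w \<and> (\<forall>b. word_perm b = w \<longrightarrow> length a \<le> length b)}"

(* Lists are indexed from 0, so a ! j is the letter a_{j+1}. *)
definition Compatible :: "int list \<Rightarrow> int list set" where
  "Compatible a =
     {i. length i = length a \<and> sorted i \<and>
         (\<forall>j. Suc j < length a \<longrightarrow> a ! j \<le> a ! Suc j \<longrightarrow> i ! j < i ! Suc j) \<and>
         (\<forall>j < length a. 0 < i ! j \<longrightarrow> i ! j \<le> a ! j)}"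

(* Positions are counted from 1: the position k compares a_k = a ! (k-1) with a_{k+1} = a ! k. *)
definition comaj :: "int list \<Rightarrow> nat" where
  "comaj a = (\<Sum>k | 1 \<le> k \<and> k < length a \<and> a ! (k - 1) < a ! k. k)"

(* A monomial in the variables x_i (i in Z) is a finitely supported exponent function. *)
type_synonym monomial = "int \<Rightarrow>\<^sub>0 nat"

(* A formal power series in the x_i is its coefficient function. *)
type_synonym pseries = "monomial \<Rightarrow> int"

(* x_{i_1} ... x_{i_p} *)
definition seq_monomial :: "int list \<Rightarrow> monomial" where
  "seq_monomial i = (\<Sum>j\<leftarrow>i. Poly_Mapping.single j 1)"

(* The coefficient of m in the formal sum over a in Reduced w and i in Compatible a of x_i.
   A sorted list is determined by its monomial, so each card is 0 or 1. *)
definition backstable_schubert :: "(int \<Rightarrow> int) \<Rightarrow> pseries" where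
  "backstable_schubert w m =
     (\<Sum>a\<in>Reduced w. int (card {i \<in> Compatible a. seq_monomial i = m}))"

(* F(x_i \<mapsto> f i). The infinite sum is taken in the standard metric topology of
   formal Laurent series. Coefficients are embedded in the rationals so that the
   Laurent series form a field. *)
definition subst_vars :: "pseries \<Rightarrow> (int \<Rightarrow> rat fls) \<Rightarrow> rat fls" where
  "subst_vars F f =
     (\<Sum>\<^sub>\<infinity>m. of_int (F m) * (\<Prod>i\<in>Poly_Mapping.keys m. f i ^ Poly_Mapping.lookup m i))"

(* The uniformizer fls_X of rat fls plays the role of 1/q, so that rat fls is the field of
   Laurent series in 1/q and its division is expansion in 1/q. *)
abbreviation q :: "rat fls" where
  "q \<equiv> fls_X_inv"

end

theory Submission
  imports Defs
begin

text \<open>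
  Work in the group algebra of the permutations of the integers, graded by word length, and write
  \<open>u\<^sub>t\<close> for the degree-one element \<open>s\<^sub>t\<close>. A compatible sequence reads a word as a product of factors
  \<open>1 + x\<^sub>i u\<^sub>t\<close> with \<open>i\<close> increasing and, for equal \<open>i\<close>, with \<open>t\<close> decreasing, so that the sum over all words is
  \<open>L = \<dots> A\<^sub>0 A\<^sub>1 \<dots> A\<^bsub>n-1\<^esub>\<close> with \<open>A\<^sub>i = (1 + q\<^bsup>i-1\<^esup> u\<^bsub>n-1\<^esub>) \<dots> (1 + q\<^bsup>i-1\<^esup> u\<^bsub>max(i,1)\<^esub>)\<close>.
  Let \<open>\<sigma>\<close> replace each \<open>u\<^sub>t\<close> by \<open>q\<^bsup>-1\<^esup> u\<^sub>t\<close>. Then \<open>A\<^bsub>i-1\<^esub> = \<sigma>(A\<^sub>i)\<close> for \<open>i \<le> 1\<close>, whereas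
  \<open>A\<^bsub>i-1\<^esub> = \<sigma>(A\<^sub>i) (1 + q\<^bsup>i-2\<^esup> u\<^bsub>i-1\<^esub>)\<close> for \<open>i \<ge> 2\<close>. The extra factors commute with everything to
  their right except each other, so \<open>L = \<sigma>(L) B\<close> with
  \<open>B = (1 + u\<^sub>1) (1 + q u\<^sub>2) \<dots> (1 + q\<^bsup>n-2\<^esup> u\<^bsub>n-1\<^esub>)\<close>. The sum of the right-hand sides of the theorem over all
  words satisfies the same equation, which has only one solution with a given degree-zero part. Neither
  side needs the words to be reduced; reducedness only enters because a reduced word of an element of
  \<open>S\<^sub>n\<close> has all its letters in \<open>{1..<n}\<close>.
\<close>

section \<open>Reduced words\<close>

lemma simple_refl_apply:
  "simple_refl t x = (if x = t then t + 1 else if x = t + 1 then t else x)"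
  by (simp add: simple_refl_def Transposition.transpose_def)

lemma simple_refl_simple_refl [simp]: "simple_refl t (simple_refl t x) = x"
  by (simp add: simple_refl_def)

lemma simple_refl_comp_simple_refl [simp]: "simple_refl t \<circ> simple_refl t = id"
  by (simp add: fun_eq_iff)

lemma simple_refl_commute:
  "t + 1 < u \<Longrightarrow> simple_refl t \<circ> simple_refl u = simple_refl u \<circ> simple_refl t"
  by (auto simp: fun_eq_iff simple_refl_apply)

lemma word_perm_Nil [simp]: "word_perm [] = id"
  by (simp add: word_perm_def)

lemma word_perm_Cons [simp]: "word_perm (t # a) = simple_refl t \<circ> word_perm a"
  by (simp add: word_perm_def)

lemma word_perm_append [simp]: "word_perm (a @ b) = word_perm a \<circ> word_perm b"
  by (induction a) (simp_all add: comp_assoc)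

lemma simple_refl_in_Bij: "simple_refl t \<in> Bij UNIV"
  unfolding Bij_def
  by (auto intro!: bij_betw_byWitness[where f' = "simple_refl t"])

text \<open>Each generator is its own inverse, so products of generators already give the whole
  group.\<close>

lemma symgrp_word:
  assumes "w \<in> symgrp n"
  shows "\<exists>a. set a \<subseteq> {1..<int n} \<and> word_perm a = w"
proof -
  interpret group "BijGroup (UNIV :: int set)"
    by (rule group_BijGroup)
  have carrier: "carrier (BijGroup (UNIV :: int set)) = Bij UNIV"
    by (simp add: BijGroup_def)
  have mult: "f \<otimes>\<^bsub>BijGroup UNIV\<^esub> g = f \<circ> g" if "f \<in> Bij UNIV" "g \<in> Bij UNIV" for f g :: "int \<Rightarrow> int"
    using that by (simp add: BijGroup_def compose_def fun_eq_iff)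
  have one: "\<one>\<^bsub>BijGroup UNIV\<^esub> = (id :: int \<Rightarrow> int)"
    by (simp add: BijGroup_def fun_eq_iff)
  have inv: "inv\<^bsub>BijGroup UNIV\<^esub> simple_refl t = simple_refl t" for t
    by (rule inv_equality) (simp_all add: carrier mult one simple_refl_in_Bij)
  have letter: "\<exists>a. set a \<subseteq> {1..<int n} \<and> word_perm a = simple_refl t" if "t \<in> {1..<int n}" for t
    using that by (intro exI[of _ "[t]"]) simp
  from assms show ?thesis
    unfolding symgrp_def
  proof (induction rule: generate.induct)
    case one
    then show ?case
      by (intro exI[of _ "[]"]) (simp add: \<open>\<one>\<^bsub>BijGroup UNIV\<^esub> = id\<close>)
  next
    case (incl h)
    then show ?case using letter by auto
  next
    case (inv h)
    then show ?case using letter \<open>\<And>t. inv\<^bsub>BijGroup UNIV\<^esub> simple_refl t = simple_refl t\<close> by auto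
  next
    case (eng h1 h2)
    then obtain a b where ab: "set a \<subseteq> {1..<int n}" "word_perm a = h1"
      "set b \<subseteq> {1..<int n}" "word_perm b = h2" by auto
    have "simple_refl ` {1..<int n} \<subseteq> carrier (BijGroup UNIV)"
      by (auto simp: carrier simple_refl_in_Bij)
    from generate_in_carrier[OF this] eng.hyps
    have "h1 \<in> Bij UNIV" "h2 \<in> Bij UNIV" by (simp_all add: carrier)
    with ab show ?case
      by (intro exI[of _ "a @ b"]) (simp add: mult)
  qed
qed

text \<open>\<open>simple_refl k\<close> is the only simple transposition that moves an integer
  across the cut between \<open>k\<close> and \<open>k + 1\<close>.\<close>

lemma word_perm_le_iff:
  assumes "k \<notin> set a"
  shows "word_perm a x \<le> k \<longleftrightarrow> x \<le> k"
  using assms by (induction a) (auto simp: simple_refl_apply)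

text \<open>The exchange property: peel letters off the left until one swaps the two images of
  \<open>i\<close> and \<open>j\<close>; deleting that letter amounts to composing with the
  transposition of their final images.\<close>

lemma exchange:
  assumes "i < j" and "word_perm c i = y" and "word_perm c j = x" and "x < y"
  shows "\<exists>c'. length c' < length c \<and> word_perm c' = Transposition.transpose x y \<circ> word_perm c"
  using assms(2-)
proof (induction c arbitrary: x y)
  case Nil
  with \<open>i < j\<close> show ?case by simp
next
  case (Cons t c)
  have ij: "word_perm c i = simple_refl t y" "word_perm c j = simple_refl t x"
    using Cons.prems by auto
  show ?case
  proof (cases "simple_refl t x < simple_refl t y")
    case True
    from Cons.IH[OF ij this] obtain c' where c': "length c' < length c"
      "word_perm c' = Transposition.transpose (simple_refl t x) (simple_refl t y) \<circ> word_perm c"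
      by blast
    have "simple_refl t (Transposition.transpose (simple_refl t x) (simple_refl t y) z) =
        Transposition.transpose x y (simple_refl t z)" for z
      by (auto simp: Transposition.transpose_def dest: arg_cong[of _ _ "simple_refl t"])
    with c' show ?thesis
      by (intro exI[of _ "t # c'"]) (simp add: fun_eq_iff)
  next
    case False
    with \<open>x < y\<close> have "x = t" "y = t + 1"
      by (auto simp: simple_refl_apply split: if_splits)
    then have "Transposition.transpose x y = simple_refl t"
      by (simp add: simple_refl_def)
    then show ?thesis
      by (intro exI[of _ c]) (simp add: fun_eq_iff)
  qed
qed

definition reduced :: "int list \<Rightarrow> bool" where
  "reduced a \<longleftrightarrow> (\<forall>b. word_perm b = word_perm a \<longrightarrow> length a \<le> length b)"

lemma reduced_append: "reduced (a @ b) \<Longrightarrow> reduced b"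
  unfolding reduced_def
proof (intro allI impI)
  fix c
  assume "\<forall>d. word_perm d = word_perm (a @ b) \<longrightarrow> length (a @ b) \<le> length d"
    and "word_perm c = word_perm b"
  from this(1)[rule_format, of "a @ c"] this(2) show "length b \<le> length c"
    by simp
qed

text \<open>The rightmost \<open>k\<close> is the first to be applied and inverts a pair on the two
  sides of the cut at \<open>k\<close>. A letter applied later that put the pair back in order
  would, by \<open>exchange\<close>, give a shorter word for the same permutation.\<close>

lemma reduced_letter_crosses:
  assumes "reduced (b @ k # c)" and "k \<notin> set c"
  shows "\<exists>i j. i \<le> k \<and> k < j \<and> word_perm (b @ k # c) j < word_perm (b @ k # c) i"
  using assms(1)
proof (induction b)
  case Nil
  \<comment> \<open>The witness is the reversed word, which inverts the permutation without new
    letters and so respects the cut at \<open>k\<close> as well.\<close>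
  have "\<exists>b. set b \<subseteq> set c \<and> word_perm c \<circ> word_perm b = id" for c
  proof (induction c)
    case (Cons t c)
    then obtain b where b: "set b \<subseteq> set c" "word_perm c \<circ> word_perm b = id" by blast
    have "word_perm c (word_perm b z) = z" for z
      using b(2) by (metis comp_apply id_apply)
    with b show ?case
      by (intro exI[of _ "b @ [t]"]) (auto simp: fun_eq_iff)
  qed auto
  then obtain b where b: "set b \<subseteq> set c" "word_perm c \<circ> word_perm b = id" by blast
  have inv: "word_perm c (word_perm b z) = z" for z
    using b(2) by (metis comp_apply id_apply)
  have "k \<notin> set b" using b(1) assms(2) by auto
  then have "word_perm b k \<le> k" "k < word_perm b (k + 1)"
    using word_perm_le_iff[of k b k] word_perm_le_iff[of k b "k + 1"] by auto
  then show ?case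
    by (intro exI[of _ "word_perm b k"] exI[of _ "word_perm b (k + 1)"])
      (simp add: inv simple_refl_apply)
next
  case (Cons t b)
  let ?d = "b @ k # c"
  have "reduced ?d"
    using Cons.prems reduced_append[of "[t]"] by simp
  with Cons.IH obtain i j where ij: "i \<le> k" "k < j" "word_perm ?d j < word_perm ?d i"
    by auto
  show ?case
  proof (cases "word_perm (t # ?d) j < word_perm (t # ?d) i")
    case True
    with ij show ?thesis by auto
  next
    case False
    with ij(3) have "word_perm ?d j = t" "word_perm ?d i = t + 1"
      by (auto simp: simple_refl_apply split: if_splits)
    then obtain c' where "length c' < length ?d"
      "word_perm c' = Transposition.transpose t (t + 1) \<circ> word_perm ?d"
      using exchange[of i j ?d "t + 1" t] ij by auto
    with Cons.prems show ?thesis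
      by (fastforce simp: reduced_def simple_refl_def)
  qed
qed

text \<open>Some word for \<open>w\<close> has all its letters in \<open>{1..<int n}\<close>, so
  \<open>w\<close> respects every cut outside this range, whereas a reduced word containing
  \<open>k\<close> yields a pair inverted across the cut at \<open>k\<close>.\<close>

lemma Reduced_letters:
  assumes "w \<in> symgrp n" and "a \<in> Reduced w"
  shows "set a \<subseteq> {1..<int n}"
proof
  fix k
  assume "k \<in> set a"
  then obtain b c where a: "a = b @ k # c" "k \<notin> set c"
    by (meson split_list_last)
  have "reduced a" and w: "word_perm a = w"
    using assms(2) by (auto simp: Reduced_def reduced_def)
  with reduced_letter_crosses a obtain i j where ij: "i \<le> k" "k < j" "w j < w i"
    by blast
  obtain d where d: "set d \<subseteq> {1..<int n}" "word_perm d = w"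
    using symgrp_word[OF assms(1)] by auto
  show "k \<in> {1..<int n}"
  proof (rule ccontr)
    assume "k \<notin> {1..<int n}"
    with d(1) have "k \<notin> set d" by auto
    with d(2) have "w i \<le> k \<longleftrightarrow> i \<le> k" "w j \<le> k \<longleftrightarrow> j \<le> k"
      using word_perm_le_iff[of k d] by auto
    with ij show False by simp
  qed
qed

section \<open>Words of fixed length as homogeneous components\<close>

definition words :: "nat \<Rightarrow> nat \<Rightarrow> (int \<Rightarrow> int) \<Rightarrow> int list set" where
  "words n p w = {a. length a = p \<and> set a \<subseteq> {1..<int n} \<and> word_perm a = w}"

lemma finite_words [simp]: "finite (words n p w)"
  by (rule finite_subset[OF _ finite_lists_length_eq[of "{1..<int n}" p]])
    (auto simp: words_def)

text \<open>With \<open>p\<close> the minimal length, reducedness becomes a condition on length and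
  letters, so an identity in degree \<open>p\<close> for all words specializes to reduced
  ones.\<close>

lemma Reduced_eq_words:
  assumes "w \<in> symgrp n"
  obtains p where "Reduced w = words n p w"
proof -
  obtain b where b: "word_perm b = w" "\<And>c. word_perm c = w \<Longrightarrow> length b \<le> length c"
    using symgrp_word[OF assms] ex_has_least_nat[of "\<lambda>b. word_perm b = w" _ length] by blast
  have "Reduced w = words n (length b) w"
    using b Reduced_letters[OF assms] by (auto simp: words_def Reduced_def intro: antisym)
  then show thesis by (rule that)
qed

section \<open>Products of linear factors\<close>

type_synonym graded = "nat \<Rightarrow> (int \<Rightarrow> int) \<Rightarrow> rat fls"

text \<open>
  \<open>f p w\<close> is the coefficient of \<open>w\<close> in degree \<open>p\<close>. In the notation of the introduction, \<open>adjoin t e\<close>, \<open>adjoin_decr n m e\<close>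
  and \<open>adjoin_incr j\<close> are right multiplication by \<open>1 + q\<^bsup>e\<^esup> u\<^sub>t\<close>, by
  \<open>(1 + q\<^bsup>e\<^esup> u\<^bsub>n-1\<^esub>) \<dots> (1 + q\<^bsup>e\<^esup> u\<^sub>m)\<close> and by \<open>(1 + u\<^sub>1) \<dots> (1 + q\<^bsup>j-1\<^esup> u\<^sub>j)\<close>, and \<open>scale_degree\<close> is \<open>\<sigma>\<close>.
\<close>

definition adjoin :: "int \<Rightarrow> int \<Rightarrow> graded \<Rightarrow> graded" where
  "adjoin t e f p w =
     f p w + (case p of 0 \<Rightarrow> 0 | Suc p' \<Rightarrow> q powi e * f p' (w \<circ> simple_refl t))"

definition scale_degree :: "graded \<Rightarrow> graded" where
  "scale_degree f p w = q powi - int p * f p w"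

definition adjoin_decr :: "nat \<Rightarrow> int \<Rightarrow> int \<Rightarrow> graded \<Rightarrow> graded" where
  "adjoin_decr n m e f = foldr (\<lambda>t. adjoin t e) [m..int n - 1] f"

primrec adjoin_incr :: "nat \<Rightarrow> graded \<Rightarrow> graded" where
  "adjoin_incr 0 f = f"
| "adjoin_incr (Suc j) f = adjoin (int j + 1) (int j) (adjoin_incr j f)"

section \<open>Commutation and scaling of the linear factors\<close>

lemma adjoin_commute:
  assumes "t + 1 < u"
  shows "adjoin t d (adjoin u e f) = adjoin u e (adjoin t d f)"
proof (intro ext)
  fix p and w :: "int \<Rightarrow> int"
  have "w \<circ> simple_refl t \<circ> simple_refl u = w \<circ> simple_refl u \<circ> simple_refl t"
    by (metis assms comp_assoc simple_refl_commute)
  then show "adjoin t d (adjoin u e f) p w = adjoin u e (adjoin t d f) p w"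
    by (simp add: adjoin_def algebra_simps split: nat.split)
qed

lemma scale_degree_adjoin: "scale_degree (adjoin t e f) = adjoin t (e - 1) (scale_degree f)"
proof (intro ext)
  fix p w
  have "q powi (- 1 - int m) * q powi e = q powi (e - 1) * q powi - int m" for m
    by (simp add: algebra_simps flip: power_int_add)
  then show "scale_degree (adjoin t e f) p w = adjoin t (e - 1) (scale_degree f) p w"
    by (cases p) (simp_all add: scale_degree_def adjoin_def algebra_simps)
qed

lemma adjoin_decr_Nil [simp]: "adjoin_decr n (int n) e f = f"
  by (simp add: adjoin_decr_def)

lemma adjoin_decr_step:
  "m < int n \<Longrightarrow> adjoin_decr n m e f = adjoin m e (adjoin_decr n (m + 1) e f)"
  by (simp add: adjoin_decr_def upto_rec1)

lemma scale_degree_adjoin_decr: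
  "scale_degree (adjoin_decr n m e f) = adjoin_decr n m (e - 1) (scale_degree f)"
proof -
  have "scale_degree (foldr (\<lambda>t. adjoin t e) ts f) = foldr (\<lambda>t. adjoin t (e - 1)) ts (scale_degree f)" for ts
    by (induction ts) (simp_all add: scale_degree_adjoin)
  then show ?thesis
    by (simp add: adjoin_decr_def)
qed

lemma adjoin_adjoin_incr:
  "int j + 1 < u \<Longrightarrow> adjoin u e (adjoin_incr j f) = adjoin_incr j (adjoin u e f)"
  by (induction j) (simp_all add: adjoin_commute[of _ u, symmetric])

lemma adjoin_decr_adjoin_incr:
  assumes "int j + 1 < m"
  shows "adjoin_decr n m e (adjoin_incr j f) = adjoin_incr j (adjoin_decr n m e f)"
proof -
  have "foldr (\<lambda>t. adjoin t e) ts (adjoin_incr j f) = adjoin_incr j (foldr (\<lambda>t. adjoin t e) ts f)"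
    if "\<forall>t\<in>set ts. int j + 1 < t" for ts
    using that by (induction ts) (simp_all add: adjoin_adjoin_incr)
  with assms show ?thesis
    by (simp add: adjoin_decr_def)
qed

text \<open>\<open>K j\<close> stands for the partial product ending in A_j. For
  \<open>j + 1 < n\<close> the \<open>adjoin_decr\<close> factor is \<sigma>(A_(j+1)), so the claim
  reads K_j = \<sigma>(K_(j+1)) (1 + u_1) ... (1 + q^(j-1) u_j). At \<open>j = n - 1\<close> that
  factor is empty, which leaves the desired equation.\<close>

lemma adjoin_decr_fixpoint:
  assumes base: "K 0 = adjoin_decr n 1 (-1) (scale_degree (K 0))"
    and step: "\<And>j. Suc j < n \<Longrightarrow> K (Suc j) = adjoin_decr n (int j + 1) (int j) (K j)"
    and "j < n"
  shows "K j = adjoin_incr j (adjoin_decr n (int j + 1) (int j - 1) (scale_degree (K j)))"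
  using \<open>j < n\<close>
proof (induction j)
  case 0
  from base show ?case by simp
next
  case (Suc j)
  let ?K = "scale_degree (K (Suc j))"
  note step = step[OF Suc.prems]
  have "K (Suc j) = adjoin_decr n (int j + 1) (int j) (adjoin_incr j ?K)"
    using Suc step scale_degree_adjoin_decr[of n "int j + 1" "int j" "K j"] by simp
  also have "\<dots> = adjoin (int j + 1) (int j) (adjoin_decr n (int j + 2) (int j) (adjoin_incr j ?K))"
    using Suc.prems by (subst adjoin_decr_step) (simp_all add: add.assoc)
  \<comment> \<open>Letters at least \<open>j + 2\<close> commute with letters at most
    \<open>j\<close>; the letter \<open>j + 1\<close> stays on the right and lengthens the
    increasing product.\<close>
  also have "\<dots> = adjoin_incr (Suc j) (adjoin_decr n (int j + 2) (int j) ?K)"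
    by (simp add: adjoin_decr_adjoin_incr)
  finally show ?case
    by (simp add: add.commute)
qed

section \<open>Uniqueness of the fixed point\<close>

lemma q_power_neq_1: "k > 0 \<Longrightarrow> q ^ k \<noteq> 1"
proof
  assume "k > 0" "q ^ k = 1"
  then have "fls_nth (q ^ k) 0 = fls_nth 1 0" by simp
  with \<open>k > 0\<close> show False by simp
qed

text \<open>Multiplication by \<open>1 + q^e u_t\<close> changes the degree \<open>p\<close> part
  only by terms from lower degree, which cancel in the difference. The first conjunct keeps the
  induction on \<open>j\<close> going.\<close>

lemma adjoin_incr_diff:
  assumes "\<And>p'. p' < p \<Longrightarrow> f p' = g p'"
  shows "(\<forall>p'<p. adjoin_incr j f p' = adjoin_incr j g p') \<and>
    adjoin_incr j f p w - adjoin_incr j g p w = f p w - g p w"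
proof (induction j)
  case 0
  with assms show ?case by simp
next
  case (Suc j)
  then show ?case
    by (auto simp: adjoin_def fun_eq_iff split: nat.split)
qed

text \<open>Once \<open>f\<close> and \<open>g\<close> agree below degree \<open>p\<close>, their
  difference \<open>d\<close> in degree \<open>p\<close> satisfies \<open>d = q^(-p) d\<close>,
  which forces \<open>d = 0\<close> when \<open>p > 0\<close>.\<close>

lemma adjoin_incr_scale_degree_unique:
  assumes f: "f = adjoin_incr j (scale_degree f)" and g: "g = adjoin_incr j (scale_degree g)"
    and "f 0 = g 0"
  shows "f = g"
proof
  fix p
  show "f p = g p"
  proof (induction p rule: less_induct)
    case (less p)
    show ?case
    proof (cases "p = 0")
      case True
      with assms show ?thesis by simp
    next
      case False
      show ?thesis
      proof
        fix w
        have "scale_degree f p' = scale_degree g p'" if "p' < p" for p'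
          using less.IH[OF that] by (simp add: scale_degree_def fun_eq_iff)
        from adjoin_incr_diff[of p "scale_degree f" "scale_degree g" j w, OF this]
        have "f p w - g p w = scale_degree f p w - scale_degree g p w"
          by (simp flip: f g)
        then have "(1 - inverse (q ^ p)) * (f p w - g p w) = 0"
          by (simp add: scale_degree_def algebra_simps power_int_minus)
        moreover have "inverse (q ^ p) \<noteq> 1"
          using q_power_neq_1[of p] False inverse_eq_1_iff by blast
        ultimately show "f p w = g p w" by simp
      qed
    qed
  qed
qed

text \<open>This is the image in the group algebra of the element of the free algebra with
  coefficients \<open>F\<close>; words with the same product are merged.\<close>

definition word_sum :: "nat \<Rightarrow> (int list \<Rightarrow> rat fls) \<Rightarrow> graded" where
  "word_sum n F p w = (\<Sum>a\<in>words n p w. F a)"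

lemma word_sum_cong:
  "(\<And>a. set a \<subseteq> {1..<int n} \<Longrightarrow> F a = G a) \<Longrightarrow> word_sum n F = word_sum n G"
  by (auto simp: word_sum_def words_def fun_eq_iff intro!: sum.cong)

lemma scale_degree_word_sum:
  "scale_degree (word_sum n F) = word_sum n (\<lambda>a. q powi - int (length a) * F a)"
  by (auto simp: scale_degree_def word_sum_def fun_eq_iff sum_distrib_left words_def intro!: sum.cong)

text \<open>Splitting off a last letter \<open>t\<close> matches words for \<open>w\<close> with
  shorter words for \<open>w \<circ> simple_refl t\<close>, as \<open>simple_refl t\<close> is an
  involution. A recursion for coefficients in the free algebra thus becomes a right
  multiplication.\<close>

lemma word_sum_adjoin:
  assumes t: "t \<in> {1..<int n}"
    and F: "\<And>a. set a \<subseteq> {1..<int n} \<Longrightarrow>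
      G a = F a + (if a \<noteq> [] \<and> last a = t then q powi e * F (butlast a) else 0)"
  shows "word_sum n G = adjoin t e (word_sum n F)"
proof (intro ext)
  fix p w
  let ?L = "{a \<in> words n p w. a \<noteq> [] \<and> last a = t}"
  have "word_sum n G p w = word_sum n F p w + (\<Sum>a\<in>?L. q powi e * F (butlast a))"
  proof -
    have "word_sum n G p w =
        (\<Sum>a\<in>words n p w. F a + (if a \<noteq> [] \<and> last a = t then q powi e * F (butlast a) else 0))"
      unfolding word_sum_def using F by (intro sum.cong) (auto simp: words_def)
    then show ?thesis
      by (simp add: word_sum_def sum.distrib sum.inter_filter)
  qed
  also have "(\<Sum>a\<in>?L. q powi e * F (butlast a)) =
      (case p of 0 \<Rightarrow> 0 | Suc p' \<Rightarrow> q powi e * word_sum n F p' (w \<circ> simple_refl t))"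
  proof (cases p)
    case 0
    then have "?L = {}" by (auto simp: words_def)
    with 0 show ?thesis by (simp del: Collect_empty_eq)
  next
    case (Suc p')
    have eq: "word_perm b \<circ> simple_refl t = w \<longleftrightarrow> word_perm b = w \<circ> simple_refl t" for b
      by (metis comp_assoc comp_id simple_refl_comp_simple_refl)
    have "(\<Sum>a\<in>?L. q powi e * F (butlast a)) =
        (\<Sum>b\<in>words n p' (w \<circ> simple_refl t). q powi e * F b)"
    proof (rule sum.reindex_bij_witness[of _ "\<lambda>b. b @ [t]" butlast])
      fix a
      assume "a \<in> ?L"
      then obtain b where "a = b @ [t]" "a \<in> words n p w"
        by (metis (mono_tags, lifting) append_butlast_last_id mem_Collect_eq)
      then show "butlast a @ [t] = a" "butlast a \<in> words n p' (w \<circ> simple_refl t)"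
        "q powi e * F (butlast a) = q powi e * F (butlast a)"
        using Suc eq[of b] by (simp_all add: words_def)
    next
      fix b
      assume "b \<in> words n p' (w \<circ> simple_refl t)"
      then show "butlast (b @ [t]) = b" "b @ [t] \<in> ?L"
        using Suc t eq[of b] by (simp_all add: words_def)
    qed
    with Suc show ?thesis
      by (simp add: word_sum_def sum_distrib_left)
  qed
  finally show "word_sum n G p w = adjoin t e (word_sum n F) p w"
    by (simp add: adjoin_def)
qed

section \<open>Functional equation for the comaj side\<close>

definition comaj_term :: "int list \<Rightarrow> rat fls" where
  "comaj_term a = q powi (sum_list a + int (comaj a)) / (\<Prod>k=1..length a. (q ^ k - 1))"

lemma comaj_snoc:
  "comaj (a @ [t]) = comaj a + (if a \<noteq> [] \<and> last a < t then length a else 0)"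
proof -
  have "{k. 1 \<le> k \<and> k < length (a @ [t]) \<and> (a @ [t]) ! (k - 1) < (a @ [t]) ! k} =
      {k. 1 \<le> k \<and> k < length a \<and> a ! (k - 1) < a ! k} \<union>
      (if a \<noteq> [] \<and> last a < t then {length a} else {})"
    by (cases "a = []") (auto simp: nth_append less_Suc_eq last_conv_nth)
  then show ?thesis
    unfolding comaj_def by (auto simp: sum.insert_if)
qed

lemma comaj_term_snoc:
  "comaj_term (a @ [t]) * (q ^ Suc (length a) - 1) =
    q powi (t + (if a \<noteq> [] \<and> last a < t then int (length a) else 0)) * comaj_term a"
  (is "_ = q powi ?e * _")
proof -
  have "q ^ Suc (length a) - 1 \<noteq> 0"
    using q_power_neq_1[of "Suc (length a)"] by simp
  moreover have "sum_list (a @ [t]) + int (comaj (a @ [t])) = ?e + (sum_list a + int (comaj a))"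
    by (simp add: comaj_snoc)
  then have "q powi (sum_list (a @ [t]) + int (comaj (a @ [t]))) =
      q powi ?e * q powi (sum_list a + int (comaj a))"
    by (simp only: power_int_add) (simp add: power_int_add)
  ultimately show ?thesis
    unfolding comaj_term_def
    by (simp del: power_Suc)
qed

text \<open>
  The coefficient of the word \<open>a\<close> in \<open>\<sigma>(R) (1 + u\<^sub>1) \<dots> (1 + q\<^bsup>j-1\<^esup> u\<^sub>j)\<close>, taken in the free algebra, where
  \<open>R\<close> is the sum of \<open>comaj_term a \<cdot> a\<close> over all words.
\<close>

definition partial_comaj_term :: "int \<Rightarrow> int list \<Rightarrow> rat fls" where
  "partial_comaj_term j a =
     (if a = [] \<or> last a \<le> j then 1 else q powi - int (length a)) * comaj_term a"

text \<open>The scaling factor changes only for a word ending in \<open>j + 1\<close>, from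
  \<open>q^(-length a)\<close> to 1. The resulting factor \<open>1 - q^(-length a)\<close> cancels
  the last denominator of \<open>comaj_term a\<close>.\<close>

lemma partial_comaj_term_step:
  "partial_comaj_term (j + 1) a = partial_comaj_term j a +
    (if a \<noteq> [] \<and> last a = j + 1 then q powi j * partial_comaj_term j (butlast a) else 0)"
proof (cases "a \<noteq> [] \<and> last a = j + 1")
  case True
  then obtain b where a: "a = b @ [j + 1]"
    by (metis append_butlast_last_id)
  define p where "p = length b"
  have one: "q ^ Suc p * q powi - int (Suc p) = 1"
    unfolding power_int_minus power_int_of_nat by (intro right_inverse power_not_zero) simp
  have "comaj_term a - q powi - int (Suc p) * comaj_term a =
      comaj_term a * (q ^ Suc p - 1) * q powi - int (Suc p)"
    by (simp only: left_diff_distrib right_diff_distrib mult.assoc one mult_1_left mult_1_right)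
      (simp only: mult.commute)
  also have "\<dots> =
      q powi (j + 1 + (if b \<noteq> [] \<and> last b < j + 1 then int p else 0)) * q powi - int (Suc p) * comaj_term b"
    unfolding a p_def comaj_term_snoc by (simp add: mult_ac)
  \<comment> \<open>A final ascent adds \<open>p\<close> to the comajor index; it occurs exactly
    when \<open>last b \<le> j\<close>, the case in which \<open>partial_comaj_term j b\<close> is
    unscaled. For empty \<open>b\<close> both cases agree, as \<open>p = 0\<close>.\<close>
  also have "q powi (j + 1 + (if b \<noteq> [] \<and> last b < j + 1 then int p else 0)) * q powi - int (Suc p) =
      q powi (j + (if b \<noteq> [] \<and> last b < j + 1 then 0 else - int p))"
    by (simp flip: power_int_add)
  also have "\<dots> * comaj_term b = q powi j * partial_comaj_term j b"
    by (auto simp: partial_comaj_term_def power_int_add p_def)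
  finally show ?thesis
    using a by (simp add: partial_comaj_term_def p_def algebra_simps)
next
  case False
  then show ?thesis
    by (auto simp: partial_comaj_term_def)
qed

text \<open>The factors are multiplied in one at a time. At \<open>j = 0\<close> every nonempty word
  is scaled since letters are positive; at \<open>j = n - 1\<close> none is, since letters are below
  \<open>n\<close>.\<close>

lemma word_sum_comaj_term_fixpoint:
  assumes "n > 0"
  shows "word_sum n comaj_term = adjoin_incr (n - 1) (scale_degree (word_sum n comaj_term))"
proof -
  have "word_sum n (partial_comaj_term (int j)) = adjoin_incr j (scale_degree (word_sum n comaj_term))"
    if "j < n" for j
    using that
  proof (induction j)
    case 0
    show ?case
      unfolding scale_degree_word_sum adjoin_incr.simps
    proof (rule word_sum_cong)
      fix a
      assume "set a \<subseteq> {1..<int n}"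
      moreover have "last a \<in> set a" if "a \<noteq> []" using that by simp
      ultimately have "a \<noteq> [] \<Longrightarrow> \<not> last a \<le> 0" by fastforce
      then show "partial_comaj_term (int 0) a = q powi - int (length a) * comaj_term a"
        by (cases "a = []") (auto simp: partial_comaj_term_def)
    qed
  next
    case (Suc j)
    have "word_sum n (partial_comaj_term (int j + 1)) =
        adjoin (int j + 1) (int j) (word_sum n (partial_comaj_term (int j)))"
      using Suc.prems by (intro word_sum_adjoin partial_comaj_term_step) simp
    with Suc show ?case
      by (simp add: add.commute)
  qed
  from this[of "n - 1"] assms
  have "word_sum n (partial_comaj_term (int (n - 1))) =
      adjoin_incr (n - 1) (scale_degree (word_sum n comaj_term))" by simp
  moreover have "word_sum n (partial_comaj_term (int (n - 1))) = word_sum n comaj_term"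
  proof (rule word_sum_cong)
    fix a
    assume "set a \<subseteq> {1..<int n}"
    moreover have "last a \<in> set a" if "a \<noteq> []" using that by simp
    ultimately have "a \<noteq> [] \<Longrightarrow> last a \<le> int (n - 1)" using assms by fastforce
    then show "partial_comaj_term (int (n - 1)) a = comaj_term a"
      by (auto simp: partial_comaj_term_def)
  qed
  ultimately show ?thesis by simp
qed

section \<open>Compatible sequences\<close>

text \<open>The exponent of \<open>1/q\<close> in the specialization of the monomial of a sequence.\<close>

definition weight :: "int list \<Rightarrow> int" where
  "weight i = (\<Sum>x\<leftarrow>i. 1 - x)"

lemma weight_simps [simp]:
  "weight [] = 0" "weight (x # i) = 1 - x + weight i" "weight (i @ j) = weight i + weight j"
  by (simp_all add: weight_def)

section \<open>Generating functions by weight\<close>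

definition bounded_seqs :: "nat \<Rightarrow> int \<Rightarrow> int list set" where
  "bounded_seqs p M = {i. length i = p \<and> set i \<subseteq> {..M}}"

lemma weight_ge: "set i \<subseteq> {..M} \<Longrightarrow> int (length i) * (1 - M) \<le> weight i"
  by (induction i) (auto simp: algebra_simps)

lemma finite_bounded_seqs_weight:
  assumes "C \<subseteq> bounded_seqs p M"
  shows "finite {i \<in> C. weight i = k}"
proof (rule finite_subset)
  \<comment> \<open>The other \<open>p - 1\<close> entries contribute at least \<open>1 - M\<close>
    each, so a fixed total weight bounds every entry from below.\<close>
  let ?m = "1 - k + (int p - 1) * (1 - M)"
  show "{i \<in> C. weight i = k} \<subseteq> {i. set i \<subseteq> {?m..M} \<and> length i = p}"
  proof safe
    fix i x
    assume i: "i \<in> C" and k: "k = weight i" and x: "x \<in> set i"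
    from i assms have i: "length i = p" "set i \<subseteq> {..M}"
      by (auto simp: bounded_seqs_def)
    from x obtain u v where uv: "i = u @ x # v"
      by (meson split_list)
    with i have "int (length u) * (1 - M) \<le> weight u" "int (length v) * (1 - M) \<le> weight v" "x \<le> M"
      by (auto intro!: weight_ge)
    moreover have "(int p - 1) * (1 - M) = int (length u) * (1 - M) + int (length v) * (1 - M)"
      using i uv by (auto simp: algebra_simps)
    ultimately show "x \<in> {1 - weight i + (int p - 1) * (1 - M)..M}"
      using uv by simp
  next
    fix i
    assume "i \<in> C"
    with assms show "length i = p" by (auto simp: bounded_seqs_def)
  qed
  show "finite {i. set i \<subseteq> {?m..M} \<and> length i = p}"
    by (rule finite_lists_length_eq) simp
qed

text \<open>\<open>Abs_fls\<close> needs coefficients that vanish for all very negative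
  \<open>k\<close>, and \<open>card\<close> needs finite sets. Both hold for sequences of fixed
  length with entries bounded above, hence \<open>bounded_seqs\<close>.\<close>

definition gf :: "int list set \<Rightarrow> rat fls" where
  "gf C = Abs_fls (\<lambda>k. of_nat (card {i \<in> C. weight i = k}))"

lemma gf_nth:
  assumes "C \<subseteq> bounded_seqs p M"
  shows "fls_nth (gf C) k = of_nat (card {i \<in> C. weight i = k})"
  unfolding gf_def
proof (rule nth_Abs_fls_lower_bound, intro allI impI)
  fix k
  assume k: "k < int p * (1 - M)"
  have "weight i \<noteq> k" if "i \<in> C" for i
    using weight_ge[of i M] that assms k by (auto simp: bounded_seqs_def)
  then show "of_nat (card {i \<in> C. weight i = k}) = (0 :: rat)"
    by (auto intro: card_eq_0_iff[THEN iffD2])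
qed

lemma gf_Un:
  assumes "C \<subseteq> bounded_seqs p M" "D \<subseteq> bounded_seqs p M" "C \<inter> D = {}"
  shows "gf (C \<union> D) = gf C + gf D"
proof (rule fls_eqI)
  fix k
  have "{i \<in> C \<union> D. weight i = k} = {i \<in> C. weight i = k} \<union> {i \<in> D. weight i = k}"
    by auto
  moreover have "{i \<in> C. weight i = k} \<inter> {i \<in> D. weight i = k} = {}"
    using assms(3) by auto
  ultimately show "fls_nth (gf (C \<union> D)) k = fls_nth (gf C + gf D) k"
    using assms finite_bounded_seqs_weight
    by (simp add: gf_nth[of _ p M] card_Un_disjoint)
qed

lemma q_powi_times_nth: "fls_nth (q powi e * f) k = fls_nth f (k + e)"
proof (cases e)
  case (nonneg m)
  then show ?thesis
    by (simp add: fls_X_inv_power_times_conv_shift)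
next
  case (neg m)
  then show ?thesis
    by (simp add: power_int_minus power_int_def fls_inverse_X_inv fls_X_power_times_conv_shift algebra_simps)
qed

lemma gf_image:
  assumes "C \<subseteq> bounded_seqs p M" "g ` C \<subseteq> bounded_seqs p' M'" "inj_on g C"
    and g: "\<And>i. i \<in> C \<Longrightarrow> weight (g i) = weight i - e"
  shows "gf (g ` C) = q powi e * gf C"
proof (rule fls_eqI)
  fix k
  have "{i \<in> g ` C. weight i = k} = g ` {i \<in> C. weight i = k + e}"
    using g by auto
  moreover have "inj_on g {i \<in> C. weight i = k + e}"
    using assms(3) by (rule inj_on_subset) auto
  ultimately show "fls_nth (gf (g ` C)) k = fls_nth (q powi e * gf C) k"
    using assms(1,2) by (simp add: gf_nth q_powi_times_nth card_image)
qed

text \<open>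
  The sequences that only use the factors \<open>1 + x\<^sub>i u\<^sub>s\<close> up to \<open>1 + x\<^sub>m u\<^sub>t\<close>. Only the last position has to be
  restricted, since the factors are used in increasing order.
\<close>

definition Compatible_upto :: "int \<Rightarrow> int \<Rightarrow> int list \<Rightarrow> int list set" where
  "Compatible_upto m t a =
     {i \<in> Compatible a. i \<noteq> [] \<longrightarrow> last i < m \<or> last i = m \<and> t \<le> last a}"

lemma Compatible_Nil [simp]: "Compatible [] = {[]}"
  by (auto simp: Compatible_def)

lemma Compatible_snoc:
  "i @ [m] \<in> Compatible (a @ [t]) \<longleftrightarrow>
    i \<in> Compatible a \<and> (0 < m \<longrightarrow> m \<le> t) \<and>
    (a \<noteq> [] \<longrightarrow> last i \<le> m \<and> (last a \<le> t \<longrightarrow> last i < m))"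
proof (cases "length i = length a")
  case True
  have sorted: "sorted (i @ [m]) \<longleftrightarrow> sorted i \<and> (a \<noteq> [] \<longrightarrow> last i \<le> m)"
    using True by (cases i rule: rev_cases) (force simp: sorted_append)+
  have bound: "(\<forall>j < Suc (length a). 0 < (i @ [m]) ! j \<longrightarrow> (i @ [m]) ! j \<le> (a @ [t]) ! j) \<longleftrightarrow>
      (\<forall>j < length a. 0 < i ! j \<longrightarrow> i ! j \<le> a ! j) \<and> (0 < m \<longrightarrow> m \<le> t)"
    using True by (auto simp: nth_append less_Suc_eq all_conj_distrib imp_disjL)
  have strict: "(\<forall>j. Suc j < Suc (length a) \<longrightarrow> (a @ [t]) ! j \<le> (a @ [t]) ! Suc j \<longrightarrow>
        (i @ [m]) ! j < (i @ [m]) ! Suc j) \<longleftrightarrow>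
      (\<forall>j. Suc j < length a \<longrightarrow> a ! j \<le> a ! Suc j \<longrightarrow> i ! j < i ! Suc j) \<and>
      (a \<noteq> [] \<longrightarrow> last a \<le> t \<longrightarrow> last i < m)"
  proof (cases "a = []")
    case False
    with True have ne: "i \<noteq> []" by auto
    let ?p = "length a - 1"
    have range: "Suc j < Suc (length a) \<longleftrightarrow> Suc j < length a \<or> j = ?p" for j
      using False by (cases a) auto
    have "(a @ [t]) ! ?p = last a" "(a @ [t]) ! Suc ?p = t" "(i @ [m]) ! ?p = last i" "(i @ [m]) ! Suc ?p = m"
      using True False ne by (auto simp: nth_append last_conv_nth)
    moreover have "(a @ [t]) ! j = a ! j" "(a @ [t]) ! Suc j = a ! Suc j"
      "(i @ [m]) ! j = i ! j" "(i @ [m]) ! Suc j = i ! Suc j" if "Suc j < length a" for j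
      using that True by (simp_all add: nth_append)
    ultimately show ?thesis
      unfolding range using False by metis
  qed simp
  have "length (i @ [m]) = length (a @ [t])"
    using True by simp
  then show ?thesis
    unfolding Compatible_def mem_Collect_eq length_append_singleton sorted bound strict
    using True by blast
qed (auto simp: Compatible_def)

lemma Compatible_length: "i \<in> Compatible a \<Longrightarrow> length i = length a"
  by (simp add: Compatible_def)

lemma Compatible_upto_bounded: "Compatible_upto m t a \<subseteq> bounded_seqs (length a) m"
proof
  fix i
  assume i: "i \<in> Compatible_upto m t a"
  then have "sorted i" "length i = length a" "i \<noteq> [] \<longrightarrow> last i \<le> m"
    by (auto simp: Compatible_upto_def Compatible_def)
  then show "i \<in> bounded_seqs (length a) m"
    by (cases i rule: rev_cases) (auto simp: bounded_seqs_def sorted_append)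
qed

text \<open>A new sequence has last entry \<open>m\<close> over last letter \<open>t\<close>.
  Removing both leaves a last entry below \<open>m\<close>, or equal to \<open>m\<close> over a
  letter greater than \<open>t\<close>, which is the restriction with \<open>t + 1\<close>.\<close>

lemma Compatible_upto_step:
  assumes "0 < m \<Longrightarrow> m \<le> t"
  shows "Compatible_upto m t a = Compatible_upto m (t + 1) a \<union>
    (if a \<noteq> [] \<and> last a = t then (\<lambda>i. i @ [m]) ` Compatible_upto m (t + 1) (butlast a) else {})"
proof (cases "a \<noteq> [] \<and> last a = t")
  case True
  then obtain b where a: "a = b @ [t]"
    by (metis append_butlast_last_id)
  have "i \<in> Compatible_upto m t a \<longleftrightarrow> i \<in> Compatible_upto m (t + 1) a \<or>
      i \<in> (\<lambda>i. i @ [m]) ` Compatible_upto m (t + 1) b" for i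
  proof (cases i rule: rev_cases)
    case Nil
    then show ?thesis
      by (auto simp: Compatible_upto_def a)
  next
    case (snoc j x)
    then show ?thesis
      using assms Compatible_length[of j b]
      by (auto simp: Compatible_upto_def a Compatible_snoc)
  qed
  with True a show ?thesis by auto
next
  case False
  then have "Compatible_upto m t a = Compatible_upto m (t + 1) a"
    by (auto simp: Compatible_upto_def Compatible_def)
  then show ?thesis
    unfolding if_not_P[OF False] by simp
qed

lemma gf_Compatible_upto_step:
  assumes "0 < m \<Longrightarrow> m \<le> t"
  shows "gf (Compatible_upto m t a) = gf (Compatible_upto m (t + 1) a) +
    (if a \<noteq> [] \<and> last a = t then q powi (m - 1) * gf (Compatible_upto m (t + 1) (butlast a)) else 0)"
proof (cases "a \<noteq> [] \<and> last a = t")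
  case True
  let ?C = "Compatible_upto m (t + 1) (butlast a)"
  have "?C \<subseteq> bounded_seqs (length (butlast a)) m"
    by (rule Compatible_upto_bounded)
  moreover from this True have snoc: "(\<lambda>i. i @ [m]) ` ?C \<subseteq> bounded_seqs (length a) m"
    by (cases a rule: rev_cases) (fastforce simp: bounded_seqs_def)+
  ultimately have "gf ((\<lambda>i. i @ [m]) ` ?C) = q powi (m - 1) * gf ?C"
    by (rule gf_image) (auto simp: inj_on_def)
  moreover have "Compatible_upto m (t + 1) a \<inter> (\<lambda>i. i @ [m]) ` ?C = {}"
    using True by (auto simp: Compatible_upto_def)
  then have "gf (Compatible_upto m (t + 1) a \<union> (\<lambda>i. i @ [m]) ` ?C) =
      gf (Compatible_upto m (t + 1) a) + gf ((\<lambda>i. i @ [m]) ` ?C)"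
    by (rule gf_Un[OF Compatible_upto_bounded snoc])
  ultimately show ?thesis
    using True Compatible_upto_step[OF assms, where a = a] by simp
next
  case False
  then show ?thesis
    using Compatible_upto_step[OF assms, where a = a] unfolding if_not_P[OF False] by simp
qed

section \<open>The sum over compatible sequences as a product\<close>

abbreviation Compatible_sum :: "nat \<Rightarrow> int \<Rightarrow> int \<Rightarrow> graded" where
  "Compatible_sum n m t \<equiv> word_sum n (\<lambda>a. gf (Compatible_upto m t a))"

lemma Compatible_sum_step:
  assumes "t \<in> {1..<int n}" and "0 < m \<Longrightarrow> m \<le> t"
  shows "Compatible_sum n m t = adjoin t (m - 1) (Compatible_sum n m (t + 1))"
  using assms by (intro word_sum_adjoin gf_Compatible_upto_step) auto

lemma Compatible_sum_adjoin_decr: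
  assumes "1 \<le> t" "t \<le> int n" and "0 < m \<Longrightarrow> m \<le> t"
  shows "Compatible_sum n m t = adjoin_decr n t (m - 1) (Compatible_sum n m (int n))"
  using assms(2,1,3)
proof (induction t rule: int_le_induct)
  case base
  then show ?case by simp
next
  case (step t)
  have "Compatible_sum n m (t - 1) = adjoin (t - 1) (m - 1) (Compatible_sum n m t)"
    using Compatible_sum_step[of "t - 1" n m] step.hyps step.prems by simp
  also have "Compatible_sum n m t = adjoin_decr n t (m - 1) (Compatible_sum n m (int n))"
    using step.IH step.prems by fastforce
  also have "adjoin (t - 1) (m - 1) \<dots> = adjoin_decr n (t - 1) (m - 1) (Compatible_sum n m (int n))"
    using step.hyps by (subst (2) adjoin_decr_step) simp_all
  finally show ?case .
qed

lemma last_letter: "set a \<subseteq> {1..<int n} \<Longrightarrow> a \<noteq> [] \<Longrightarrow> 1 \<le> last a \<and> last a < int n"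
  using last_in_set[of a] by fastforce

lemma Compatible_last_le:
  assumes "i \<in> Compatible a" "i \<noteq> []" "0 < last i"
  shows "last i \<le> last a"
proof -
  have "length i = length a" "a \<noteq> []"
    using assms(1,2) by (auto simp: Compatible_def)
  with assms show ?thesis
    by (auto simp: Compatible_def last_conv_nth)
qed

text \<open>No letter reaches \<open>n\<close>, so a last entry \<open>m\<close> is excluded, and a
  last entry \<open>m - 1\<close> automatically sits over a letter at least
  \<open>max 1 (m - 1)\<close>. Hence the start of A_m is the end of A_(m-1).\<close>

lemma Compatible_upto_pred:
  assumes "set a \<subseteq> {1..<int n}"
  shows "Compatible_upto m (int n) a = Compatible_upto (m - 1) (max 1 (m - 1)) a"
proof -
  have "last i < m \<or> last i = m \<and> int n \<le> last a \<longleftrightarrow>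
      last i < m - 1 \<or> last i = m - 1 \<and> max 1 (m - 1) \<le> last a"
    if "i \<in> Compatible a" "i \<noteq> []" for i
  proof -
    have "a \<noteq> []" using that by (auto simp: Compatible_def)
    with last_letter[OF assms] Compatible_last_le[OF that] show ?thesis
      by linarith
  qed
  then show ?thesis
    by (auto simp: Compatible_upto_def)
qed

lemma Compatible_upto_top:
  assumes "set a \<subseteq> {1..<int n}" "n > 0"
  shows "Compatible_upto (int n - 1) (max 1 (int n - 1)) a = Compatible a"
proof -
  have "last i < int n - 1 \<or> last i = int n - 1 \<and> max 1 (int n - 1) \<le> last a"
    if "i \<in> Compatible a" "i \<noteq> []" for i
  proof -
    have "a \<noteq> []" using that by (auto simp: Compatible_def)
    with last_letter[OF assms(1)] Compatible_last_le[OF that] assms(2) show ?thesis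
      by linarith
  qed
  then show ?thesis
    by (auto simp: Compatible_upto_def)
qed

lemma sorted_last_less_iff:
  "sorted i \<Longrightarrow> (i \<noteq> [] \<longrightarrow> last i < (c :: int)) \<longleftrightarrow> (\<forall>x\<in>set i. x < c)"
  by (cases i rule: rev_cases) (auto simp: sorted_append)

text \<open>Entries below \<open>c \<le> 1\<close> are nonpositive, so the bound by the letters
  holds vacuously, and what remains besides \<open>x < c\<close> is invariant under
  translation.\<close>

lemma Compatible_nonpos:
  assumes "c \<le> 1"
  shows "{i \<in> Compatible a. i \<noteq> [] \<longrightarrow> last i < c} =
    {i. length i = length a \<and> sorted i \<and>
        (\<forall>j. Suc j < length a \<longrightarrow> a ! j \<le> a ! Suc j \<longrightarrow> i ! j < i ! Suc j) \<and> (\<forall>x\<in>set i. x < c)}"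
proof -
  have "\<forall>j<length a. 0 < i ! j \<longrightarrow> i ! j \<le> a ! j" if "\<forall>x\<in>set i. x < c" "length i = length a" for i
    using that assms by (metis nth_mem linorder_not_less order_less_le_trans zless_add1_eq int_one_le_iff_zero_less)
  then have "i \<in> Compatible a \<and> (i \<noteq> [] \<longrightarrow> last i < c) \<longleftrightarrow> length i = length a \<and> sorted i \<and>
      (\<forall>j. Suc j < length a \<longrightarrow> a ! j \<le> a ! Suc j \<longrightarrow> i ! j < i ! Suc j) \<and> (\<forall>x\<in>set i. x < c)" for i
    unfolding Compatible_def mem_Collect_eq using sorted_last_less_iff[of i c] by blast
  then show ?thesis by simp
qed

lemma sorted_map_pred: "sorted (map (\<lambda>x. x - 1) i) \<longleftrightarrow> sorted (i :: int list)"
  by (induction i) auto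

lemma Compatible_upto_shift:
  assumes "set a \<subseteq> {1..<int n}"
  shows "Compatible_upto 0 (int n) a = map (\<lambda>x. x - 1) ` Compatible_upto 0 1 a"
proof -
  define P where "P c = {i. length i = length a \<and> sorted i \<and>
    (\<forall>j. Suc j < length a \<longrightarrow> a ! j \<le> a ! Suc j \<longrightarrow> i ! j < i ! Suc j) \<and> (\<forall>x\<in>set i. x < c)}"
    for c :: int
  have "Compatible_upto 0 (int n) a = {i \<in> Compatible a. i \<noteq> [] \<longrightarrow> last i < 0}"
    using last_letter[OF assms] by (force simp: Compatible_upto_def Compatible_def)
  then have neg: "Compatible_upto 0 (int n) a = P 0"
    by (simp add: Compatible_nonpos P_def)
  have "Compatible_upto 0 1 a = {i \<in> Compatible a. i \<noteq> [] \<longrightarrow> last i < 1}"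
    using last_letter[OF assms] by (force simp: Compatible_upto_def Compatible_def)
  then have nonpos: "Compatible_upto 0 1 a = P 1"
    by (simp add: Compatible_nonpos P_def)
  have "map (\<lambda>x. x - 1) ` P 1 = P 0"
  proof (intro equalityI subsetI)
    fix i
    assume "i \<in> P 0"
    then have "map (\<lambda>x. x + 1) i \<in> P 1"
      by (auto simp: P_def sorted_map sorted_wrt_iff_nth_less)
    moreover have "i = map (\<lambda>x. x - 1) (map (\<lambda>x. x + 1) i)"
      by (simp add: comp_def)
    ultimately show "i \<in> map (\<lambda>x. x - 1) ` P 1" by blast
  next
    fix i
    assume "i \<in> map (\<lambda>x. x - 1) ` P 1"
    then show "i \<in> P 0"
      by (auto simp: P_def sorted_map_pred)
  qed
  with neg nonpos show ?thesis by simp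
qed

lemma weight_map_pred: "weight (map (\<lambda>x. x - 1) i) = weight i + int (length i)"
  by (induction i) auto

text \<open>Lowering every entry by one raises the weight by the length. Summed over words, this
  says that the product of all A_i with \<open>i < 0\<close> is \<sigma> of the product of those
  with \<open>i \<le> 0\<close>.\<close>

lemma gf_Compatible_upto_shift:
  assumes "set a \<subseteq> {1..<int n}"
  shows "gf (Compatible_upto 0 (int n) a) = q powi - int (length a) * gf (Compatible_upto 0 1 a)"
  unfolding Compatible_upto_shift[OF assms]
proof (rule gf_image)
  show "map (\<lambda>x. x - 1) ` Compatible_upto 0 1 a \<subseteq> bounded_seqs (length a) 0"
    using Compatible_upto_bounded unfolding Compatible_upto_shift[OF assms, symmetric] .
  show "weight (map (\<lambda>x. x - 1) i) = weight i - - int (length a)" if "i \<in> Compatible_upto 0 1 a" for i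
    using that by (auto simp: weight_map_pred Compatible_upto_def Compatible_def)
  show "inj_on (map (\<lambda>x. x - 1)) (Compatible_upto 0 1 a)"
    by (rule inj_on_subset[OF inj_mapI]) (auto simp: inj_def)
qed (rule Compatible_upto_bounded)

lemma word_sum_Compatible_fixpoint:
  assumes "n > 0"
  shows "word_sum n (\<lambda>a. gf (Compatible a)) =
    adjoin_incr (n - 1) (scale_degree (word_sum n (\<lambda>a. gf (Compatible a))))"
proof -
  \<comment> \<open>\<open>K j\<close> is the product of all A_i with \<open>i \<le> j\<close>;
    \<open>max 1 (int j)\<close> is the lower limit of the letters in A_j.\<close>
  define K where "K j = Compatible_sum n (int j) (max 1 (int j))" for j
  have "K 0 = adjoin_decr n 1 (-1) (Compatible_sum n 0 (int n))"
    using Compatible_sum_adjoin_decr[of 1 n 0] assms by (simp add: K_def)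
  also have "Compatible_sum n 0 (int n) = scale_degree (K 0)"
    unfolding scale_degree_word_sum K_def by (rule word_sum_cong) (simp add: gf_Compatible_upto_shift)
  finally have base: "K 0 = adjoin_decr n 1 (-1) (scale_degree (K 0))" .
  have step: "K (Suc j) = adjoin_decr n (int j + 1) (int j) (K j)" if "Suc j < n" for j
  proof -
    have "K (Suc j) = adjoin_decr n (int j + 1) (int j) (Compatible_sum n (int (Suc j)) (int n))"
      using Compatible_sum_adjoin_decr[of "int (Suc j)" n "int (Suc j)"] that
      by (simp add: K_def add.commute)
    also have "Compatible_sum n (int (Suc j)) (int n) = K j"
      unfolding K_def by (rule word_sum_cong) (simp add: Compatible_upto_pred)
    finally show ?thesis .
  qed
  have fixpoint: "K (n - 1) =
      adjoin_incr (n - 1) (adjoin_decr n (int (n - 1) + 1) (int (n - 1) - 1) (scale_degree (K (n - 1))))"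
    using assms by (intro adjoin_decr_fixpoint[where K = K, OF base step]) simp_all
  have top: "int (n - 1) + 1 = int n"
    using assms by simp
  have K: "K (n - 1) = word_sum n (\<lambda>a. gf (Compatible a))"
    unfolding K_def
  proof (rule word_sum_cong)
    fix a
    assume "set a \<subseteq> {1..<int n}"
    from Compatible_upto_top[OF this assms] assms
    show "gf (Compatible_upto (int (n - 1)) (max 1 (int (n - 1))) a) = gf (Compatible a)"
      by (simp add: of_nat_diff)
  qed
  from fixpoint show ?thesis
    unfolding top adjoin_decr_Nil K .
qed

lemma gf_single_Nil: "gf {[]} = 1"
proof (rule fls_eqI)
  fix k
  have "{i \<in> {[] :: int list}. weight i = k} = (if k = 0 then {[]} else {})"
    by auto
  then show "fls_nth (gf {[]}) k = fls_nth 1 k"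
    by (simp add: gf_nth[of _ 0 0] bounded_seqs_def)
qed

lemma word_sum_Compatible_eq:
  assumes "n > 0"
  shows "word_sum n (\<lambda>a. gf (Compatible a)) = word_sum n comaj_term"
proof (rule adjoin_incr_scale_degree_unique)
  show "word_sum n (\<lambda>a. gf (Compatible a)) =
      adjoin_incr (n - 1) (scale_degree (word_sum n (\<lambda>a. gf (Compatible a))))"
    using assms by (rule word_sum_Compatible_fixpoint)
  show "word_sum n comaj_term = adjoin_incr (n - 1) (scale_degree (word_sum n comaj_term))"
    using assms by (rule word_sum_comaj_term_fixpoint)
  show "word_sum n (\<lambda>a. gf (Compatible a)) 0 = word_sum n comaj_term 0"
    by (auto simp: word_sum_def words_def fun_eq_iff gf_single_Nil comaj_term_def comaj_def
        intro!: sum.cong)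
qed

section \<open>Specialization\<close>

text \<open>Two Laurent series are close when their difference has large subdegree, so convergence
  follows once all coefficients up to any given degree are eventually those of the limit.\<close>

lemma has_sum_flsI:
  fixes f :: "'b \<Rightarrow> 'a::ab_group_add fls"
  assumes "\<And>N. \<exists>F0. finite F0 \<and> F0 \<subseteq> A \<and>
    (\<forall>F. finite F \<and> F0 \<subseteq> F \<and> F \<subseteq> A \<longrightarrow> (\<forall>k\<le>int N. fls_nth (sum f F) k = fls_nth s k))"
  shows "(f has_sum s) A"
  unfolding has_sum_def
proof (rule tendstoI)
  fix e :: real
  assume "e > 0"
  then obtain N where "(inverse 2) ^ N < e"
    using real_arch_pow_inv[of e "inverse 2"] by auto
  then have N: "inverse (2 ^ N) < e"
    by (simp only: power_inverse)
  obtain F0 where F0: "finite F0" "F0 \<subseteq> A"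
    and coeff: "\<forall>F. finite F \<and> F0 \<subseteq> F \<and> F \<subseteq> A \<longrightarrow>
      (\<forall>k\<le>int N. fls_nth (sum f F) k = fls_nth s k)"
    using assms[of N] by (elim exE conjE)
  have "dist (sum f F) s < e" if "finite F" "F0 \<subseteq> F" "F \<subseteq> A" for F
  proof (cases "sum f F = s")
    case True
    with \<open>e > 0\<close> show ?thesis by simp
  next
    case False
    have deg: "int N \<le> fls_subdegree (sum f F - s)"
      using coeff that False by (intro fls_subdegree_geI) simp_all
    then have "2 ^ N \<le> (2 ^ nat (fls_subdegree (sum f F - s)) :: real)"
      by (intro power_increasing) simp_all
    then have "inverse (2 ^ nat (fls_subdegree (sum f F - s))) \<le> inverse (2 ^ N :: real)"
      by (rule le_imp_inverse_le) (rule zero_less_power, simp)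
    also note N
    finally show ?thesis
      using False deg unfolding dist_fls_def by (simp only: if_False if_True order_trans[OF of_nat_0_le_iff deg])
  qed
  with F0 show "\<forall>\<^sub>F F in finite_subsets_at_top A. dist (sum f F) s < e"
    unfolding eventually_finite_subsets_at_top by blast
qed

section \<open>Specializing monomials at powers of q\<close>

definition monomial_weight :: "monomial \<Rightarrow> int" where
  "monomial_weight m = (\<Sum>i\<in>Poly_Mapping.keys m. int (Poly_Mapping.lookup m i) * (1 - i))"

lemma monomial_weight_superset:
  assumes "finite S" "Poly_Mapping.keys m \<subseteq> S"
  shows "monomial_weight m = (\<Sum>i\<in>S. int (Poly_Mapping.lookup m i) * (1 - i))"
  unfolding monomial_weight_def
  using assms by (intro sum.mono_neutral_left) (auto simp: in_keys_iff)

lemma monomial_weight_single_add: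
  "monomial_weight (Poly_Mapping.single x 1 + m) = 1 - x + monomial_weight m"
proof -
  let ?S = "insert x (Poly_Mapping.keys m)"
  have "Poly_Mapping.keys (Poly_Mapping.single x 1 + m) \<subseteq> ?S"
    using Poly_Mapping.keys_add[of "Poly_Mapping.single x 1" m] by auto
  then have "monomial_weight (Poly_Mapping.single x 1 + m) =
      (\<Sum>i\<in>?S. int (Poly_Mapping.lookup (Poly_Mapping.single x 1 + m) i) * (1 - i))"
    by (intro monomial_weight_superset) auto
  also have "\<dots> = (\<Sum>i\<in>?S. (if i = x then 1 - i else 0) + int (Poly_Mapping.lookup m i) * (1 - i))"
    by (intro sum.cong) (auto simp: lookup_add lookup_single when_def algebra_simps)
  also have "\<dots> = (\<Sum>i\<in>?S. if i = x then 1 - i else 0) + monomial_weight m"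
    by (subst monomial_weight_superset[of ?S]) (auto simp: sum.distrib)
  also have "(\<Sum>i\<in>?S. if i = x then 1 - i else 0) = 1 - x"
    by (subst sum.delta) auto
  finally show ?thesis .
qed

lemma monomial_weight_seq_monomial [simp]: "monomial_weight (seq_monomial i) = weight i"
proof (induction i)
  case Nil
  show ?case
    by (simp add: seq_monomial_def monomial_weight_def)
next
  case (Cons x i)
  have "seq_monomial (x # i) = Poly_Mapping.single x 1 + seq_monomial i"
    by (simp add: seq_monomial_def)
  with Cons show ?case
    by (simp only: monomial_weight_single_add weight_simps)
qed

lemma prod_q_powi_lookup:
  "(\<Prod>i\<in>Poly_Mapping.keys m. (q powi (i - 1)) ^ Poly_Mapping.lookup m i) = q powi - monomial_weight m"
proof -
  have "(\<Prod>i\<in>A. (q powi (i - 1)) ^ c i) = q powi - (\<Sum>i\<in>A. int (c i) * (1 - i))" if "finite A"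
    for A and c :: "int \<Rightarrow> nat"
    using that
  proof (induction A rule: finite_induct)
    case (insert x A)
    have "(q powi (x - 1)) ^ c x = q powi ((x - 1) * int (c x))"
      by (simp only: power_int_mult power_int_of_nat)
    moreover have "(x - 1) * int (c x) = - (int (c x) * (1 - x))"
      by (simp add: algebra_simps)
    ultimately have "(q powi (x - 1)) ^ c x = q powi - (int (c x) * (1 - x))"
      by simp
    with insert show ?case
      by (simp add: power_int_add[symmetric] del: power_int_add)
  qed simp
  then show ?thesis
    by (simp add: monomial_weight_def)
qed

lemma of_int_times_q_powi_nth:
  "fls_nth (of_int c * q powi - e) k = (if k = e then of_int c else 0)"
proof -
  have "fls_nth (of_int c * q powi - e) k = fls_nth (q powi - e * of_int c) k"
    by (simp only: mult.commute)
  also have "\<dots> = (if k = e then of_int c else 0)"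
    unfolding q_powi_times_nth by (simp add: fls_of_int_nth)
  finally show ?thesis .
qed

lemma Compatible_bounded:
  assumes "a \<in> words n p w" "n > 0"
  shows "Compatible a \<subseteq> bounded_seqs p (int n - 1)"
proof -
  have "set a \<subseteq> {1..<int n}" "length a = p"
    using assms(1) by (auto simp: words_def)
  then show ?thesis
    using Compatible_upto_bounded[of "int n - 1" "max 1 (int n - 1)" a] assms(2)
    by (simp only: Compatible_upto_top)
qed

text \<open>Sorting monomials by weight makes each coefficient of the infinite sum a finite sum over
  \<open>M k\<close>, which counts the compatible sequences of weight \<open>k\<close>.\<close>

lemma subst_vars_backstable_schubert:
  assumes "n > 0" and R: "Reduced w = words n p w"
  shows "subst_vars (backstable_schubert w) (\<lambda>i. q powi (i - 1)) = (\<Sum>a\<in>Reduced w. gf (Compatible a))"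
proof -
  let ?C = "\<lambda>a k. {i \<in> Compatible a. weight i = k}"
  let ?f = "\<lambda>m. of_int (backstable_schubert w m) * q powi - monomial_weight m"
  define M where "M k = (\<Union>a\<in>Reduced w. seq_monomial ` ?C a k)" for k
  have bounded: "Compatible a \<subseteq> bounded_seqs p (int n - 1)" if "a \<in> Reduced w" for a
    using Compatible_bounded that assms by auto
  have finC: "finite (?C a k)" if "a \<in> Reduced w" for a k
    using finite_bounded_seqs_weight bounded[OF that] .
  have finM: "finite (M k)" for k
    unfolding M_def using finC R by (intro finite_UN_I) auto
  have M_weight: "monomial_weight m = k" if "m \<in> M k" for m k
    using that by (auto simp: M_def)
  have M_support: "m \<in> M (monomial_weight m)" if "backstable_schubert w m \<noteq> 0" for m
  proof -
    from that obtain a where a: "a \<in> Reduced w" "card {i \<in> Compatible a. seq_monomial i = m} \<noteq> 0"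
      unfolding backstable_schubert_def by (rule sum.not_neutral_contains_not_neutral) simp
    then have "{i \<in> Compatible a. seq_monomial i = m} \<noteq> {}"
      by (metis card.empty)
    with a(1) show ?thesis
      by (force simp: M_def)
  qed
  have M_empty: "M k = {}" if "k < int p * (1 - (int n - 1))" for k
  proof -
    have "int p * (1 - (int n - 1)) \<le> weight i" if "a \<in> Reduced w" "i \<in> Compatible a" for a i
      using bounded[OF that(1)] that(2) weight_ge[of i "int n - 1"]
      unfolding bounded_seqs_def by blast
    with that have "?C a k = {}" if "a \<in> Reduced w" for a
      using \<open>a \<in> Reduced w\<close> by force
    then show ?thesis
      unfolding M_def by blast
  qed
  have coeff: "(\<Sum>m\<in>M k. of_int (backstable_schubert w m)) = fls_nth (\<Sum>a\<in>Reduced w. gf (Compatible a)) k"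
    for k
  proof -
    have "(\<Sum>m\<in>M k. card {i \<in> Compatible a. seq_monomial i = m}) = card (?C a k)"
      if a: "a \<in> Reduced w" for a
    proof -
      have "?C a k = (\<Union>m\<in>M k. {i \<in> Compatible a. seq_monomial i = m})"
      proof
        show "?C a k \<subseteq> (\<Union>m\<in>M k. {i \<in> Compatible a. seq_monomial i = m})"
          using a unfolding M_def by blast
        show "(\<Union>m\<in>M k. {i \<in> Compatible a. seq_monomial i = m}) \<subseteq> ?C a k"
          by (auto dest!: M_weight)
      qed
      also have "card \<dots> = (\<Sum>m\<in>M k. card {i \<in> Compatible a. seq_monomial i = m})"
      proof (rule card_UN_disjoint[OF finM])
        show "\<forall>m\<in>M k. finite {i \<in> Compatible a. seq_monomial i = m}"
        proof
          fix m
          assume "m \<in> M k"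
          then have "{i \<in> Compatible a. seq_monomial i = m} \<subseteq> ?C a k"
            using M_weight[OF \<open>m \<in> M k\<close>] by auto
          then show "finite {i \<in> Compatible a. seq_monomial i = m}"
            using finC[OF a] by (rule finite_subset)
        qed
      qed auto
      finally show ?thesis ..
    qed
    then have "(\<Sum>a\<in>Reduced w. \<Sum>m\<in>M k. of_nat (card {i \<in> Compatible a. seq_monomial i = m})) =
        (\<Sum>a\<in>Reduced w. of_nat (card (?C a k)) :: rat)"
      by (intro sum.cong) (simp_all flip: of_nat_sum)
    moreover have "(\<Sum>m\<in>M k. of_int (backstable_schubert w m)) =
        (\<Sum>a\<in>Reduced w. \<Sum>m\<in>M k. of_nat (card {i \<in> Compatible a. seq_monomial i = m}) :: rat)"
      unfolding backstable_schubert_def by (subst sum.swap) simp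
    moreover have "(\<Sum>a\<in>Reduced w. of_nat (card (?C a k))) = (\<Sum>a\<in>Reduced w. fls_nth (gf (Compatible a)) k)"
      by (intro sum.cong refl gf_nth[OF bounded, symmetric])
    ultimately show ?thesis
      by (simp only: fls_nth_sum)
  qed
  have "(?f has_sum (\<Sum>a\<in>Reduced w. gf (Compatible a))) UNIV"
  proof (rule has_sum_flsI)
    fix N
    \<comment> \<open>A finite set containing every \<open>M k\<close> with
      \<open>k \<le> int N\<close> fixes the coefficients up to \<open>N\<close>. Below the lower
      limit \<open>M k\<close> is empty, so finitely many \<open>k\<close> suffice.\<close>
    let ?F0 = "\<Union>k\<in>{int p * (1 - (int n - 1))..int N}. M k"
    have "fls_nth (sum ?f F) k = fls_nth (\<Sum>a\<in>Reduced w. gf (Compatible a)) k"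
      if F: "finite F" "?F0 \<subseteq> F" and k: "k \<le> int N" for F k
    proof -
      have "M k \<subseteq> F"
      proof (cases "k < int p * (1 - (int n - 1))")
        case True
        then show ?thesis
          using M_empty by blast
      next
        case False
        with k have "k \<in> {int p * (1 - (int n - 1))..int N}"
          by (simp only: atLeastAtMost_iff not_less)
        with F(2) show ?thesis by blast
      qed
      have "fls_nth (sum ?f F) k =
          (\<Sum>m\<in>F. if k = monomial_weight m then of_int (backstable_schubert w m) else 0)"
        by (simp only: fls_nth_sum of_int_times_q_powi_nth)
      also have "\<dots> = (\<Sum>m\<in>M k. of_int (backstable_schubert w m))"
      proof (intro sum.mono_neutral_cong_right ballI)
        fix m
        assume "m \<in> F - M k"
        then show "(if k = monomial_weight m then of_int (backstable_schubert w m) else 0) = (0 :: rat)"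
          using M_support[of m] by auto
      next
        fix m
        assume "m \<in> M k"
        then show "(if k = monomial_weight m then of_int (backstable_schubert w m) else 0) =
            (of_int (backstable_schubert w m) :: rat)"
          using M_weight by simp
      qed (fact F(1) \<open>M k \<subseteq> F\<close>)+
      finally show ?thesis
        by (simp only: coeff)
    qed
    then show "\<exists>F0. finite F0 \<and> F0 \<subseteq> UNIV \<and>
        (\<forall>F. finite F \<and> F0 \<subseteq> F \<and> F \<subseteq> UNIV \<longrightarrow>
          (\<forall>k\<le>int N. fls_nth (sum ?f F) k = fls_nth (\<Sum>a\<in>Reduced w. gf (Compatible a)) k))"
      using finM by (intro exI[of _ ?F0] conjI finite_UN_I) blast+
  qed
  then show ?thesis
    unfolding subst_vars_def prod_q_powi_lookup by (rule infsumI)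
qed

theorem theorem1p5:
  fixes n :: nat and w :: "int \<Rightarrow> int"
  assumes "n > 0" and "w \<in> symgrp n"
  shows "subst_vars (backstable_schubert w) (\<lambda>i. q powi (i - 1)) =
    (\<Sum>a\<in>Reduced w.
       q powi (sum_list a + int (comaj a)) / (\<Prod>k=1..length a. (q ^ k - 1)))"
proof -
  obtain p where R: "Reduced w = words n p w"
    using Reduced_eq_words[OF assms(2)] .
  \<comment> \<open>The identity of graded sums is read off in degree \<open>p\<close> at
    \<open>w\<close>, the component indexed by the reduced words.\<close>
  have "(\<Sum>a\<in>Reduced w. gf (Compatible a)) = (\<Sum>a\<in>Reduced w. comaj_term a)"
    using fun_cong[OF fun_cong[OF word_sum_Compatible_eq[OF assms(1)]], of p w]
    by (simp add: word_sum_def R)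
  then show ?thesis
    unfolding subst_vars_backstable_schubert[OF assms(1) R] comaj_term_def .
qed

end
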